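(* Let $\Gamma$ be an arrangement of $n\geq 2$ pseudocircles with $f_n(\Gamma)>0$. Then for every integer $k$ with $0\leq k\leq n-2$, \[ v_{\leq k}(\Gamma)\;\leq\; 2(k+1)n-(k+1)(k+2). \]
   Context: A pseudocircle is a simple closed (Jordan) curve in the plane; $\mathrm{int}(\gamma)$ denotes its interior, the bounded component of its complement. An arrangement of pseudocircles is a finite set $\Gamma=\{\gamma_1,\dots,\gamma_n\}$ of pseudocircles such that no three of them pass through a common point, any two have at most two points in common, and at each common point of two of them the two curves cross. Vertices are the intersection points of pairs of pseudocircles; faces are the connected components of the complement of $\bigcup_i\gamma_i$. The weight of a vertex or face is the number of $\gamma_i$ whose interior contains it. $v_{\leq k}(\Gamma)$ is the number of vertices of weight at most $k$; $f_n(\Gamma)$ is the number of faces of weight $n$ (faces contained in the interior of every pseudocircle). *)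

theory Defs
  imports "HOL-Analysis.Analysis"
begin

definition pseudocircle :: "complex set \<Rightarrow> bool" where
  "pseudocircle C \<longleftrightarrow> (\<exists>g :: real \<Rightarrow> complex.
      simple_path g \<and> pathfinish g = pathstart g \<and> path_image g = C)"

definition crosses_at :: "complex set \<Rightarrow> complex set \<Rightarrow> complex \<Rightarrow> bool" where
  "crosses_at C D p \<longleftrightarrow> (\<forall>e>0. D \<inter> ball p e \<inter> inside C \<noteq> {} \<and> D \<inter> ball p e \<inter> outside C \<noteq> {})"

definition pc_arrangement :: "complex set set \<Rightarrow> bool" where
  "pc_arrangement \<Gamma> \<longleftrightarrow> finite \<Gamma> \<and> (\<forall>C\<in>\<Gamma>. pseudocircle C)
    \<and> (\<forall>A\<in>\<Gamma>. \<forall>B\<in>\<Gamma>. \<forall>C\<in>\<Gamma>. A \<noteq> B \<and> A \<noteq> C \<and> B \<noteq> C \<longrightarrow> A \<inter> B \<inter> C = {})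
    \<and> (\<forall>A\<in>\<Gamma>. \<forall>B\<in>\<Gamma>. A \<noteq> B \<longrightarrow> finite (A \<inter> B) \<and> card (A \<inter> B) \<le> 2)
    \<and> (\<forall>A\<in>\<Gamma>. \<forall>B\<in>\<Gamma>. A \<noteq> B \<longrightarrow> (\<forall>p\<in>A \<inter> B. crosses_at A B p \<and> crosses_at B A p))"

definition arr_vertices :: "complex set set \<Rightarrow> complex set" where
  "arr_vertices \<Gamma> = {p. \<exists>A\<in>\<Gamma>. \<exists>B\<in>\<Gamma>. A \<noteq> B \<and> p \<in> A \<and> p \<in> B}"

definition arr_faces :: "complex set set \<Rightarrow> complex set set" where
  "arr_faces \<Gamma> = components (- \<Union>\<Gamma>)"

definition point_weight :: "complex set set \<Rightarrow> complex \<Rightarrow> nat" where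
  "point_weight \<Gamma> p = card {C\<in>\<Gamma>. p \<in> inside C}"

definition face_weight :: "complex set set \<Rightarrow> complex set \<Rightarrow> nat" where
  "face_weight \<Gamma> F = card {C\<in>\<Gamma>. F \<subseteq> inside C}"

definition v_le :: "complex set set \<Rightarrow> nat \<Rightarrow> nat" where
  "v_le \<Gamma> k = card {p\<in>arr_vertices \<Gamma>. point_weight \<Gamma> p \<le> k}"

definition f_eq :: "complex set set \<Rightarrow> nat \<Rightarrow> nat" where
  "f_eq \<Gamma> j = card {F\<in>arr_faces \<Gamma>. face_weight \<Gamma> F = j}"

end

theory Submission
  imports Defs
begin

text \<open>Let \<open>C\<close> be a pseudocircle with a point \<open>c\<close> that lies inside all other pseudocircles. Traverse \<open>C\<close>
  starting from \<open>c\<close>. Each of the at most two points of \<open>C \<inter> D\<close> is the first or the last point of \<open>C\<close> on \<open>D\<close>.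
  Among the first points of weight at most \<open>k\<close>, the earliest one lies inside every \<open>D\<close> whose first
  point comes later, so there are at most \<open>min (k + 1) (n - 1)\<close> of them; by symmetry the same holds for
  last points. Hence \<open>C\<close> carries at most \<open>2 * min (k + 1) (n - 1)\<close> vertices of weight at most \<open>k\<close>, and
  one can remove \<open>C\<close> and induct. Such a \<open>C\<close> and \<open>c\<close> exist: the intersection of all interiors is a nonempty
  bounded open set, so its frontier is infinite and contains a point that is not a vertex.\<close>

section \<open>Frontiers of bounded open sets\<close>

text \<open>In dimension at least 2 a finite set does not separate the space. A finite frontier
  would thus have a connected complement, which meets \<open>U\<close> because \<open>U\<close> is
  open and leaves \<open>U\<close> because \<open>U\<close> is bounded, yet never crosses the
  frontier.\<close>

lemma infinite_frontier:
  fixes U :: "'a::euclidean_space set"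
  assumes "bounded U" "U \<noteq> {}" "open U" "2 \<le> DIM('a)"
  shows "infinite (frontier U)"
proof
  assume fin: "finite (frontier U)"
  have "connected (- frontier U)"
    using connected_open_delete_finite[OF open_UNIV connected_UNIV assms(4) fin]
    by (simp add: Compl_eq_Diff_UNIV)
  moreover have "- frontier U \<inter> U \<noteq> {}"
    using assms by (auto simp: frontier_def interior_open)
  moreover have "- frontier U - U \<noteq> {}"
  proof
    assume "- frontier U - U = {}"
    then have "UNIV = frontier U \<union> U" by auto
    moreover have "bounded (frontier U \<union> U)"
      using fin assms(1) by (simp add: finite_imp_bounded)
    ultimately show False using not_bounded_UNIV by metis
  qed
  ultimately show False
    using connected_Int_frontier by blast
qed

section \<open>First points of a path on a family of curves\<close>

definition first_hit :: "(real \<Rightarrow> 'a) \<Rightarrow> 'a set \<Rightarrow> real \<Rightarrow> bool" where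
  "first_hit g D t \<longleftrightarrow> t \<in> {0..1} \<and> g t \<in> D \<and> (\<forall>s\<in>{0..<t}. g s \<notin> D)"

text \<open>The family \<open>\<D>\<close> will be the arrangement without the traversed curve. Last
  points are obtained by using \<open>reversepath g\<close> for \<open>g\<close>.\<close>

definition low_first_hits :: "(real \<Rightarrow> complex) \<Rightarrow> complex set set \<Rightarrow> nat \<Rightarrow> complex set" where
  "low_first_hits g \<D> k = {p. point_weight \<D> p \<le> k \<and> (\<exists>D\<in>\<D>. \<exists>t. first_hit g D t \<and> p = g t)}"

lemma first_hit_unique: "first_hit g D t \<Longrightarrow> first_hit g D u \<Longrightarrow> t = u"
  unfolding first_hit_def by (metis atLeastAtMost_iff atLeastLessThan_iff linorder_neqE)

text \<open>The initial arc up to \<open>s\<close> is connected and misses \<open>D\<close>, so it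
  stays in the component of \<open>- D\<close> that contains \<open>g 0\<close>.\<close>

lemma before_first_hit_inside:
  fixes g :: "real \<Rightarrow> 'a::euclidean_space"
  assumes "path g" "g 0 \<in> inside D" "first_hit g D t" "s \<in> {0..<t}"
  shows "g s \<in> inside D"
proof -
  have t: "t \<le> 1" "\<And>r. r \<in> {0..<t} \<Longrightarrow> g r \<notin> D"
    using assms(3) by (auto simp: first_hit_def)
  have "connected (g ` {0..s})"
    using assms(1,4) t(1)
    by (intro connected_continuous_image) (auto simp: path_def intro: continuous_on_subset)
  moreover have "g ` {0..s} \<subseteq> - D" using t(2) assms(4) by force
  ultimately have "connected_component (- D) (g 0) (g s)"
    using assms(4) unfolding connected_component_def
    by (intro exI[of _ "g ` {0..s}"]) auto
  then show ?thesis using assms(2) inside_same_component by blast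
qed

lemma card_low_first_hits:
  assumes g: "path g" and fin: "finite \<D>" and c: "\<And>D. D \<in> \<D> \<Longrightarrow> g 0 \<in> inside D"
  shows "finite (low_first_hits g \<D> k)" (is "finite ?P")
    and "card (low_first_hits g \<D> k) \<le> min (k + 1) (card \<D>)"
proof -
  have "\<forall>p\<in>?P. \<exists>D. D \<in> \<D> \<and> (\<exists>t. first_hit g D t \<and> p = g t)"
    by (auto simp: low_first_hits_def)
  then obtain d where "\<forall>p\<in>?P. d p \<in> \<D> \<and> (\<exists>t. first_hit g (d p) t \<and> p = g t)"
    by (rule bchoice[THEN exE])
  then have d: "d p \<in> \<D>" and "\<exists>t. first_hit g (d p) t \<and> p = g t" if "p \<in> ?P" for p
    using that by auto
  then have "\<forall>p\<in>?P. \<exists>t. first_hit g (d p) t \<and> p = g t" by blast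
  then obtain \<tau> where "\<forall>p\<in>?P. first_hit g (d p) (\<tau> p) \<and> p = g (\<tau> p)"
    by (rule bchoice[THEN exE])
  then have hit: "first_hit g (d p) (\<tau> p)" and \<tau>: "g (\<tau> p) = p" if "p \<in> ?P" for p
    using that by auto
  \<comment> \<open>A curve has only one first point, so the chosen curve \<open>d p\<close>
    determines \<open>p\<close>.\<close>
  have inj: "inj_on d ?P"
    using hit \<tau> first_hit_unique by (metis inj_onI)
  have sub: "d ` ?P \<subseteq> \<D>" using d by blast
  show finP: "finite ?P"
    using inj sub fin by (metis finite_imageD finite_subset)
  have "card ?P \<le> card \<D>"
    using inj sub fin by (metis card_image card_mono)
  moreover have "card ?P \<le> k + 1"
  proof (cases "?P = {}")
    case False
    then obtain p where p: "p \<in> ?P" and min: "\<And>q. q \<in> ?P \<Longrightarrow> \<tau> p \<le> \<tau> q"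
      using ex_is_arg_min_if_finite[OF finP, of \<tau>] by (auto simp: is_arg_min_linorder)
    have "p \<in> inside (d q)" if q: "q \<in> ?P" "q \<noteq> p" for q
    proof -
      have "\<tau> p \<noteq> \<tau> q" using \<tau>[OF p] \<tau>[OF q(1)] q(2) by auto
      then have "\<tau> p \<in> {0..<\<tau> q}" using min[OF q(1)] hit[OF p] by (auto simp: first_hit_def)
      then show ?thesis
        using before_first_hit_inside[OF g c hit[OF q(1)]] d[OF q(1)] \<tau>[OF p] by metis
    qed
    \<comment> \<open>The curve \<open>d p\<close> passes through \<open>p\<close> and is left out
      of the count; this accounts for the \<open>+ 1\<close> in the bound.\<close>
    then have "d ` (?P - {p}) \<subseteq> {D \<in> \<D>. p \<in> inside D}" using d by auto
    then have "card (d ` (?P - {p})) \<le> point_weight \<D> p"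
      unfolding point_weight_def using fin by (intro card_mono) auto
    moreover have "card (d ` (?P - {p})) = card ?P - 1"
      using inj p finP by (subst card_image) (auto intro: inj_on_subset)
    moreover have "point_weight \<D> p \<le> k" using p by (simp add: low_first_hits_def)
    ultimately show ?thesis by linarith
  qed simp
  ultimately show "card ?P \<le> min (k + 1) (card \<D>)" by simp
qed

section \<open>A curve with a point inside all the others\<close>

lemma pseudocircle_closed: "pseudocircle C \<Longrightarrow> closed C"
  unfolding pseudocircle_def by (metis closed_path_image simple_path_imp_path)

lemma finite_arr_vertices:
  assumes "pc_arrangement \<Gamma>"
  shows "finite (arr_vertices \<Gamma>)"
proof (rule finite_subset)
  show "arr_vertices \<Gamma> \<subseteq> (\<Union>A\<in>\<Gamma>. \<Union>B\<in>\<Gamma> - {A}. A \<inter> B)"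
    unfolding arr_vertices_def by blast
  show "finite (\<Union>A\<in>\<Gamma>. \<Union>B\<in>\<Gamma> - {A}. A \<inter> B)"
    using assms unfolding pc_arrangement_def by (intro finite_UN_I) auto
qed

lemma exists_point_inside_others:
  assumes arr: "pc_arrangement \<Gamma>" and ne: "\<Gamma> \<noteq> {}" and z: "z \<in> (\<Inter>C\<in>\<Gamma>. inside C)"
  obtains C c where "C \<in> \<Gamma>" "c \<in> C" "\<And>D. D \<in> \<Gamma> - {C} \<Longrightarrow> c \<in> inside D"
proof -
  define U where "U = (\<Inter>C\<in>\<Gamma>. inside C)"
  have fin: "finite \<Gamma>" and pc: "\<And>C. C \<in> \<Gamma> \<Longrightarrow> pseudocircle C"
    using arr unfolding pc_arrangement_def by auto
  have "open U"
    unfolding U_def using fin pc by (intro open_INT) (auto intro: open_inside pseudocircle_closed)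
  moreover have "bounded U"
  proof -
    obtain C where C: "C \<in> \<Gamma>" using ne by blast
    then have "bounded C"
      using pc[OF C] unfolding pseudocircle_def by (metis bounded_path_image simple_path_imp_path)
    then have "bounded (inside C)" by (rule bounded_inside)
    then show ?thesis by (rule bounded_subset) (use C in \<open>auto simp: U_def\<close>)
  qed
  moreover have "U \<noteq> {}" using z U_def by blast
  ultimately have "infinite (frontier U)" by (intro infinite_frontier) auto
  then obtain c where c: "c \<in> frontier U" "c \<notin> arr_vertices \<Gamma>"
    using finite_arr_vertices[OF arr] by (meson finite_subset subsetI)
  \<comment> \<open>Being a limit of points of \<open>U\<close>, the point \<open>c\<close> can
    leave an interior only by lying on its curve. Since \<open>c\<close> is outside the open set
    \<open>U\<close>, this happens for some \<open>C\<close>, and only for that one since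
    \<open>c\<close> is not a vertex.\<close>
  have closure: "c \<in> D \<union> inside D" if "D \<in> \<Gamma>" for D
  proof -
    have "c \<in> closure (inside D)"
      using c(1) that closure_mono[of U "inside D"] by (auto simp: frontier_def U_def)
    then show ?thesis using closure_inside_subset[OF pseudocircle_closed[OF pc[OF that]]] by blast
  qed
  have "c \<notin> U" using c(1) \<open>open U\<close> by (simp add: frontier_def interior_open)
  then obtain C where C: "C \<in> \<Gamma>" "c \<notin> inside C" using U_def by blast
  then have "c \<in> C" using closure by blast
  moreover have "c \<in> inside D" if "D \<in> \<Gamma> - {C}" for D
  proof -
    have "c \<notin> D" using c(2) \<open>c \<in> C\<close> C(1) that unfolding arr_vertices_def by blast
    then show ?thesis using closure that by blast
  qed
  ultimately show thesis using that C(1) by blast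
qed

section \<open>Vertices on one curve\<close>

text \<open>A hit that is neither first nor last has one before and one after it, which makes three
  points on \<open>D\<close>. Parameter \<open>t\<close> of \<open>g\<close> is parameter
  \<open>1 - t\<close> of the reversed path.\<close>

lemma closed_path_hit_first_or_last:
  assumes g: "simple_path g" "pathfinish g = pathstart g"
    and D: "finite (path_image g \<inter> D)" "card (path_image g \<inter> D) \<le> 2" "pathstart g \<notin> D"
    and t: "t \<in> {0..1}" "g t \<in> D"
  shows "first_hit g D t \<or> first_hit (reversepath g) D (1 - t)"
proof (rule ccontr)
  assume neg: "\<not> ?thesis"
  then obtain r where r: "0 \<le> r" "r < t" "g r \<in> D"
    using t by (auto simp: first_hit_def)
  from neg obtain s' where "0 \<le> s'" "s' < 1 - t" "g (1 - s') \<in> D"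
    using t by (auto simp: first_hit_def reversepath_def)
  then obtain s where s: "t < s" "s \<le> 1" "g s \<in> D"
    by (intro that[of "1 - s'"]) auto
  \<comment> \<open>A simple closed path repeats a value only at the parameters 0 and 1; as the
    starting point is off \<open>D\<close>, neither can be a hit, so the three points are
    distinct.\<close>
  have "r \<noteq> 0" "s \<noteq> 1" using g(2) D(3) r(3) s(3) by (auto simp: pathstart_def pathfinish_def)
  then have "g r \<noteq> g t" "g t \<noteq> g s" "g r \<noteq> g s"
    using g(1) r s unfolding simple_path_def loop_free_def by fastforce+
  then have "card {g r, g t, g s} = 3" by simp
  moreover have "{g r, g t, g s} \<subseteq> path_image g \<inter> D"
    using r s t by (auto simp: path_image_def)
  ultimately have "3 \<le> card (path_image g \<inter> D)" using card_mono[OF D(1)] by metis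
  then show False using D(2) by simp
qed

lemma pseudocircle_path_from:
  assumes "pseudocircle C" "c \<in> C"
  obtains g where "simple_path g" "pathfinish g = pathstart g" "path_image g = C" "pathstart g = c"
proof -
  obtain g where g: "simple_path g" "pathfinish g = pathstart g" "path_image g = C"
    using assms(1) unfolding pseudocircle_def by blast
  obtain a where a: "a \<in> {0..1}" "g a = c" using assms(2) g(3) by (auto simp: path_image_def)
  show thesis
  proof (rule that)
    show "simple_path (shiftpath a g)" using g a by (simp add: simple_path_shiftpath)
    show "path_image (shiftpath a g) = C" using g a by (simp add: path_image_shiftpath)
    show "pathstart (shiftpath a g) = c" using g a by (simp add: pathstart_shiftpath)
    then show "pathfinish (shiftpath a g) = pathstart (shiftpath a g)"
      using endpoints_shiftpath[OF g(2) a(1)] by simp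
  qed
qed

lemma card_vertices_on_curve:
  assumes arr: "pc_arrangement \<Gamma>" and C: "C \<in> \<Gamma>" and c: "c \<in> C"
    and ins: "\<And>D. D \<in> \<Gamma> - {C} \<Longrightarrow> c \<in> inside D"
  shows "card {p \<in> arr_vertices \<Gamma>. point_weight \<Gamma> p \<le> k \<and> p \<in> C} \<le> 2 * min (k + 1) (card \<Gamma> - 1)"
    (is "card ?V \<le> _")
proof -
  have fin: "finite \<Gamma>" and pc: "pseudocircle C" using arr C unfolding pc_arrangement_def by auto
  obtain g where g: "simple_path g" "pathfinish g = pathstart g" "path_image g = C" "pathstart g = c"
    using pseudocircle_path_from[OF pc c] .
  define \<D> where "\<D> = \<Gamma> - {C}"
  have fD: "finite \<D>" using fin by (simp add: \<D>_def)
  have gp: "path g" "path (reversepath g)" using simple_path_imp_path[OF g(1)] by simp_all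
  have "g 0 = c" "reversepath g 0 = c"
    using g(2,4) by (auto simp: reversepath_def pathstart_def pathfinish_def)
  then have c0: "g 0 \<in> inside D" "reversepath g 0 \<in> inside D" if "D \<in> \<D>" for D
    using ins[of D] that by (auto simp: \<D>_def)
  have first: "finite (low_first_hits g \<D> k)" "card (low_first_hits g \<D> k) \<le> min (k + 1) (card \<D>)"
    using card_low_first_hits[OF gp(1) fD] c0(1) by blast+
  have last: "finite (low_first_hits (reversepath g) \<D> k)"
    "card (low_first_hits (reversepath g) \<D> k) \<le> min (k + 1) (card \<D>)"
    using card_low_first_hits[OF gp(2) fD] c0(2) by blast+
  have "p \<in> low_first_hits g \<D> k \<union> low_first_hits (reversepath g) \<D> k" if p: "p \<in> ?V" for p
  proof -
    have "point_weight \<D> p \<le> point_weight \<Gamma> p"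
      unfolding point_weight_def \<D>_def using fin by (intro card_mono) auto
    then have w: "point_weight \<D> p \<le> k" using p by simp
    obtain D where D: "D \<in> \<D>" "p \<in> D"
      using p unfolding arr_vertices_def \<D>_def by blast
    obtain t where t: "t \<in> {0..1}" "p = g t" using p g(3) by (auto simp: path_image_def)
    have "finite (C \<inter> D)" "card (C \<inter> D) \<le> 2"
      using arr C D(1) unfolding pc_arrangement_def \<D>_def by auto
    moreover have "c \<notin> D" using ins[of D] D(1) inside_no_overlap unfolding \<D>_def by blast
    ultimately have "first_hit g D t \<or> first_hit (reversepath g) D (1 - t)"
      using closed_path_hit_first_or_last[OF g(1,2), of D t] g(3,4) t D(2) by auto
    moreover have "p = reversepath g (1 - t)" using t by (simp add: reversepath_def)
    ultimately show ?thesis using w D(1) t(2) unfolding low_first_hits_def by blast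
  qed
  then have "card ?V \<le> card (low_first_hits g \<D> k \<union> low_first_hits (reversepath g) \<D> k)"
    using first(1) last(1) by (intro card_mono) auto
  also have "\<dots> \<le> card (low_first_hits g \<D> k) + card (low_first_hits (reversepath g) \<D> k)"
    by (rule card_Un_le)
  also have "\<dots> \<le> 2 * min (k + 1) (card \<D>)" using add_mono[OF first(2) last(2)] by (simp only: mult_2)
  also have "card \<D> = card \<Gamma> - 1" using C by (simp add: \<D>_def)
  finally show ?thesis .
qed

section \<open>Induction on the number of curves and the closed form\<close>

text \<open>The summand for \<open>i\<close> bounds half the number of low vertices on a curve with
  \<open>i\<close> others present. A common interior point \<open>z\<close> replaces the face of
  full weight because it clearly survives the removal of a curve.\<close>

lemma v_le_sum_bound:
  assumes "card \<Gamma> = n" "pc_arrangement \<Gamma>" "z \<in> (\<Inter>C\<in>\<Gamma>. inside C)"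
  shows "v_le \<Gamma> k \<le> 2 * (\<Sum>i<n. min (k + 1) i)"
  using assms
proof (induction n arbitrary: \<Gamma>)
  case 0
  then have "\<Gamma> = {}" by (simp add: pc_arrangement_def)
  then show ?case by (simp add: v_le_def arr_vertices_def)
next
  case (Suc n)
  have fin: "finite \<Gamma>" using Suc.prems(2) by (simp add: pc_arrangement_def)
  have "\<Gamma> \<noteq> {}" using Suc.prems(1) by auto
  then obtain C c where C: "C \<in> \<Gamma>" "c \<in> C" "\<And>D. D \<in> \<Gamma> - {C} \<Longrightarrow> c \<in> inside D"
    using exists_point_inside_others[OF Suc.prems(2) _ Suc.prems(3)] by blast
  let ?\<Delta> = "\<Gamma> - {C}"
  have arr: "pc_arrangement ?\<Delta>" using Suc.prems(2) unfolding pc_arrangement_def by simp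
  let ?on = "{p \<in> arr_vertices \<Gamma>. point_weight \<Gamma> p \<le> k \<and> p \<in> C}"
  let ?off = "{p \<in> arr_vertices ?\<Delta>. point_weight ?\<Delta> p \<le> k}"
  have "point_weight ?\<Delta> p \<le> point_weight \<Gamma> p" for p
    unfolding point_weight_def using fin by (intro card_mono) auto
  \<comment> \<open>A vertex off \<open>C\<close> is an intersection of two remaining curves, and
    removing \<open>C\<close> does not raise its weight.\<close>
  then have "{p \<in> arr_vertices \<Gamma>. point_weight \<Gamma> p \<le> k} \<subseteq> ?on \<union> ?off"
    unfolding arr_vertices_def by (auto intro: order_trans)
  then have "v_le \<Gamma> k \<le> card (?on \<union> ?off)"
    unfolding v_le_def using finite_arr_vertices[OF arr] finite_arr_vertices[OF Suc.prems(2)]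
    by (intro card_mono) auto
  also have "\<dots> \<le> card ?on + v_le ?\<Delta> k" unfolding v_le_def by (rule card_Un_le)
  also have "\<dots> \<le> 2 * min (k + 1) n + 2 * (\<Sum>i<n. min (k + 1) i)"
    using card_vertices_on_curve[OF Suc.prems(2) C, of k] Suc.IH[OF _ arr] Suc.prems C(1) fin
    by (intro add_mono) auto
  finally show ?case by simp
qed

text \<open>The terms below \<open>m\<close> form a triangular number, the base case; each later
  term adds the constant \<open>m\<close>.\<close>

lemma sum_min_lessThan:
  assumes "m \<le> n"
  shows "2 * (\<Sum>i<n. int (min m i)) = 2 * int m * int n - int m * (int m + 1)"
  using assms
proof (induction n rule: dec_induct)
  case base
  have "2 * (\<Sum>i<m. int i) = int m * int m - int m"
    by (induction m) (auto simp: algebra_simps)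
  then show ?case by (simp add: algebra_simps)
next
  case (step n)
  then show ?case by (simp add: algebra_simps)
qed

theorem theorem2p2:
  fixes \<Gamma> :: "complex set set" and n k :: nat
  assumes "pc_arrangement \<Gamma>"
    and "n = card \<Gamma>" and "n \<ge> 2"
    and "f_eq \<Gamma> n > 0"
    and "k \<le> n - 2"
  shows "int (v_le \<Gamma> k) \<le> 2 * (int k + 1) * int n - (int k + 1) * (int k + 2)"
proof -
  have fin: "finite \<Gamma>" using assms(1) by (simp add: pc_arrangement_def)
  obtain F where F: "F \<in> arr_faces \<Gamma>" "face_weight \<Gamma> F = n"
    using assms(4) unfolding f_eq_def by (auto simp: card_gt_0_iff)
  then have "{C \<in> \<Gamma>. F \<subseteq> inside C} = \<Gamma>"
    using fin assms(2) unfolding face_weight_def by (intro card_subset_eq) auto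
  moreover obtain z where "z \<in> F"
    using F(1) in_components_nonempty unfolding arr_faces_def by blast
  ultimately have "z \<in> (\<Inter>C\<in>\<Gamma>. inside C)" by blast
  then have "v_le \<Gamma> k \<le> 2 * (\<Sum>i<n. min (k + 1) i)"
    using v_le_sum_bound assms(1,2) by blast
  then have "int (v_le \<Gamma> k) \<le> 2 * (\<Sum>i<n. int (min (k + 1) i))"
    by (metis of_nat_le_iff of_nat_mult of_nat_numeral of_nat_sum)
  also have "\<dots> = 2 * (int k + 1) * int n - (int k + 1) * (int k + 2)"
    \<comment> \<open>The bounds on \<open>k\<close> and \<open>n\<close> give
      \<open>k + 1 \<le> n\<close>, so the closed form applies with
      \<open>m = k + 1\<close>.\<close>
    using sum_min_lessThan[of "k + 1" n] assms(3,5) by (simp add: algebra_simps)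
  finally show ?thesis .
qed

end
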